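(* Let $n$ and $k$ be non-negative integers with $k \geq \frac{n-\binom{k+1}{2}}{2}$. Then the statistics $h_{1,1}$ and $a_2$ are equidistributed on the set of partitions of $n$ whose $2$-core has size $\binom{k+1}{2}$; that is, for every $r\ge 0$, the number of such partitions $\lambda$ with $h_{1,1}(\lambda)=r$ equals the number of such partitions with $a_2(\lambda)=r$.
   Context: Partitions are viewed as Young diagrams (English notation). For a cell $v$, the arm length $a_v$ is the number of cells to its right in its row, and the leg length $l_v$ is the number of cells below it in its column. $h_{1,1}(\lambda)$ is the number of cells $v$ of $\lambda$ with $l_v=a_v+1$. $a_2(\lambda)$ is the largest part of $\lambda$ that appears at least twice (and $0$ if no part is repeated). The $2$-core of $\lambda$ is the partition obtained by repeatedly removing from the Young diagram a domino (two adjacent cells forming a rim hook of length $2$) whose removal leaves a Young diagram, until no such domino exists; it is well defined and equals a staircase $(k,k-1,\dots,1)$ for some $k\ge 0$, of size $\binom{k+1}{2}$. *)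

theory Defs
  imports Complex_Main
begin

section \<open>Partitions and Young diagrams\<close>

text \<open>A partition is the weakly decreasing list of its (positive) parts.\<close>

definition is_partition :: "nat list \<Rightarrow> bool" where
  "is_partition \<mu> \<longleftrightarrow> sorted_wrt (\<ge>) \<mu> \<and> (\<forall>p \<in> set \<mu>. p > 0)"

text \<open>English notation, with rows and columns counted from 0: the cell \<open>(i, j)\<close> lies in
  row \<open>i\<close> (from the top) and column \<open>j\<close> (from the left).\<close>

definition diagram :: "nat list \<Rightarrow> (nat \<times> nat) set" where
  "diagram \<mu> = {(i, j). i < length \<mu> \<and> j < \<mu> ! i}"

definition arm :: "nat list \<Rightarrow> nat \<times> nat \<Rightarrow> nat" where
  "arm \<mu> v = card {j. j > snd v \<and> (fst v, j) \<in> diagram \<mu>}"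

definition leg :: "nat list \<Rightarrow> nat \<times> nat \<Rightarrow> nat" where
  "leg \<mu> v = card {i. i > fst v \<and> (i, snd v) \<in> diagram \<mu>}"

definition h11 :: "nat list \<Rightarrow> nat" where
  "h11 \<mu> = card {v \<in> diagram \<mu>. leg \<mu> v = arm \<mu> v + 1}"

definition a2 :: "nat list \<Rightarrow> nat" where
  "a2 \<mu> = Max (insert 0 {p \<in> set \<mu>. count_list \<mu> p \<ge> 2})"


section \<open>The 2-core\<close>

definition is_domino :: "(nat \<times> nat) set \<Rightarrow> bool" where
  "is_domino A \<longleftrightarrow> (\<exists>i j. A = {(i, j), (i, Suc j)} \<or> A = {(i, j), (Suc i, j)})"

definition removes_domino :: "nat list \<Rightarrow> nat list \<Rightarrow> bool" where
  "removes_domino \<mu> \<nu> \<longleftrightarrow> is_partition \<mu> \<and> is_partition \<nu> \<and>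
     (\<exists>A. is_domino A \<and> A \<subseteq> diagram \<mu> \<and> diagram \<nu> = diagram \<mu> - A)"

definition is_two_core_of :: "nat list \<Rightarrow> nat list \<Rightarrow> bool" where
  "is_two_core_of \<nu> \<mu> \<longleftrightarrow> removes_domino\<^sup>*\<^sup>* \<mu> \<nu> \<and> \<not> (\<exists>\<rho>. removes_domino \<nu> \<rho>)"

text \<open>Exists and is unique: see \<open>is_two_core_of_exists\<close> and
  \<open>is_two_core_of_unique\<close> below.\<close>

definition two_core :: "nat list \<Rightarrow> nat list" where
  "two_core \<mu> = (THE \<nu>. is_two_core_of \<nu> \<mu>)"

definition partitions_with_core_size :: "nat \<Rightarrow> nat \<Rightarrow> nat list set" where
  "partitions_with_core_size n c =
     {\<mu>. is_partition \<mu> \<and> sum_list \<mu> = n \<and> sum_list (two_core \<mu>) = c}"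


section \<open>The 2-core is well defined\<close>

definition is_diagram :: "(nat \<times> nat) set \<Rightarrow> bool" where
  "is_diagram D \<longleftrightarrow> finite D \<and>
     (\<forall>i j i' j'. (i, j) \<in> D \<longrightarrow> i' \<le> i \<longrightarrow> j' \<le> j \<longrightarrow> (i', j') \<in> D)"

lemma is_diagram_down: "is_diagram D \<Longrightarrow> (i, j) \<in> D \<Longrightarrow> i' \<le> i \<Longrightarrow> j' \<le> j \<Longrightarrow> (i', j') \<in> D"
  unfolding is_diagram_def by blast

lemma finite_diagram: "finite (diagram \<mu>)"
proof -
  have "diagram \<mu> = (SIGMA i:{..<length \<mu>}. {..<\<mu> ! i})"
    by (auto simp: diagram_def)
  then show ?thesis by simp
qed

lemma is_diagram_diagram:
  assumes "is_partition \<mu>" shows "is_diagram (diagram \<mu>)"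
proof -
  have anti: "\<mu> ! i \<le> \<mu> ! i'" if "i' \<le> i" "i < length \<mu>" for i i'
    using assms that unfolding is_partition_def sorted_wrt_iff_nth_less
    by (cases "i' = i") auto
  then show ?thesis
    unfolding is_diagram_def
  proof (intro conjI finite_diagram allI impI)
    fix i j i' j' assume "(i, j) \<in> diagram \<mu>" "i' \<le> i" "j' \<le> j"
    with anti[of i' i] show "(i', j') \<in> diagram \<mu>"
      by (simp add: diagram_def)
  qed
qed

lemma down_set_nat:
  fixes S :: "nat set"
  assumes "finite S" "\<And>x y. x \<in> S \<Longrightarrow> y \<le> x \<Longrightarrow> y \<in> S"
  shows "S = {..<card S}"
proof (cases "S = {}")
  case False
  then have "Max S \<in> S" using assms(1) by simp
  have "S = {..Max S}"
  proof (intro equalityI subsetI)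
    fix x assume "x \<in> S" then show "x \<in> {..Max S}" using assms(1) by simp
  next
    fix x assume "x \<in> {..Max S}"
    then show "x \<in> S" using assms(2)[OF \<open>Max S \<in> S\<close>, of x] by simp
  qed
  then have "card S = Suc (Max S)" by (metis card_atMost)
  then have "{..<card S} = {..Max S}" by (simp only: lessThan_Suc_atMost)
  with \<open>S = {..Max S}\<close> show ?thesis by (rule trans[OF _ sym])
qed simp

lemma diagram_surj:
  assumes D: "is_diagram D"
  obtains \<mu> where "is_partition \<mu>" "diagram \<mu> = D"
proof -
  define r where "r i = card {j. (i, j) \<in> D}" for i
  define m where "m = card {i. (i, 0) \<in> D}"
  have fin: "finite D" using D by (simp add: is_diagram_def)
  have finr: "finite {j. (i, j) \<in> D}" for i
    by (rule finite_subset[of _ "snd ` D"]) (use fin in \<open>force+\<close>)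
  have finc: "finite {i. (i, 0) \<in> D}"
    by (rule finite_subset[of _ "fst ` D"]) (use fin in \<open>force+\<close>)
  have r: "{j. (i, j) \<in> D} = {..<r i}" for i
    unfolding r_def by (rule down_set_nat[OF finr]) (auto intro: is_diagram_down[OF D])
  have m: "{i. (i, 0) \<in> D} = {..<m}"
    unfolding m_def by (rule down_set_nat[OF finc]) (auto intro: is_diagram_down[OF D])
  have mem: "(i, j) \<in> D \<longleftrightarrow> j < r i" for i j
    using r[of i] by auto
  have mem0: "0 < r i \<longleftrightarrow> i < m" for i
  proof -
    have "i \<in> {i. (i, 0) \<in> D} \<longleftrightarrow> i \<in> {..<m}"
      by (simp only: m)
    then show ?thesis by (simp add: mem)
  qed
  have anti: "r i' \<le> r i" if "i \<le> i'" for i i'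
  proof (rule ccontr)
    assume "\<not> r i' \<le> r i"
    then have "(i', r i) \<in> D" by (simp add: mem)
    then have "(i, r i) \<in> D" using that by (rule is_diagram_down[OF D]) simp
    then show False by (simp add: mem)
  qed
  let ?l = "map r [0..<m]"
  have "is_partition ?l"
    unfolding is_partition_def sorted_wrt_iff_nth_less using anti mem0 by auto
  moreover have "diagram ?l = D"
  proof -
    have "i < m" if "j < r i" for i j
      using that mem0[of i] by simp
    then show ?thesis
      unfolding diagram_def by (auto simp: mem)
  qed
  ultimately show ?thesis using that by blast
qed

lemma diagram_inj:
  assumes "is_partition \<mu>" "is_partition \<nu>" "diagram \<mu> = diagram \<nu>"
  shows "\<mu> = \<nu>"
proof -
  have *: "(i, 0) \<in> diagram \<rho> \<longleftrightarrow> i < length \<rho>" if "is_partition \<rho>" for i \<rho>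
    using that by (auto simp: diagram_def is_partition_def)
  have len: "length \<mu> = length \<nu>"
    using *[OF assms(1)] *[OF assms(2)] assms(3) by (metis linorder_neqE_nat less_irrefl)
  show ?thesis
  proof (rule nth_equalityI[OF len])
    fix i assume i: "i < length \<mu>"
    have "{j. (i, j) \<in> diagram \<mu>} = {..<\<mu> ! i}" "{j. (i, j) \<in> diagram \<nu>} = {..<\<nu> ! i}"
      using i len by (auto simp: diagram_def)
    with assms(3) show "\<mu> ! i = \<nu> ! i" by auto
  qed
qed

lemma removes_domino_card:
  assumes "removes_domino \<mu> \<nu>"
  shows "card (diagram \<nu>) < card (diagram \<mu>)"
proof -
  obtain A where A: "is_domino A" "A \<subseteq> diagram \<mu>" "diagram \<nu> = diagram \<mu> - A"
    using assms unfolding removes_domino_def by auto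
  then have "diagram \<nu> \<subset> diagram \<mu>"
    unfolding is_domino_def by auto
  then show ?thesis by (rule psubset_card_mono[OF finite_diagram])
qed

lemma removable_upD:
  assumes "is_diagram (D - A)" "(i, j) \<in> A" "(i', j') \<in> D" "i \<le> i'" "j \<le> j'"
  shows "(i', j') \<in> A"
  using assms is_diagram_down[of "D - A" i' j' i j] by blast

lemma is_diagram_DiffI:
  assumes "is_diagram D"
    and "\<And>i j i' j'. (i, j) \<in> A \<Longrightarrow> (i', j') \<in> D \<Longrightarrow> i \<le> i' \<Longrightarrow> j \<le> j' \<Longrightarrow> (i', j') \<in> A"
  shows "is_diagram (D - A)"
  using assms unfolding is_diagram_def by blast

text \<open>Two distinct removable dominoes are either disjoint, or are the two dominoes containing
  the lower right cell of a removable square.\<close>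

lemma domino_overlap:
  assumes "is_domino A" "is_domino B" "A \<noteq> B" "A \<inter> B \<noteq> {}" "A \<subseteq> D" "B \<subseteq> D"
    "is_diagram (D - A)" "is_diagram (D - B)"
  obtains i j where "A = {(i, Suc j), (Suc i, Suc j)}" "B = {(Suc i, j), (Suc i, Suc j)}"
    | i j where "B = {(i, Suc j), (Suc i, Suc j)}" "A = {(Suc i, j), (Suc i, Suc j)}"
proof -
  note up = removable_upD[OF assms(7)] removable_upD[OF assms(8)]
  from assms(1) obtain i j where A: "A = {(i, j), (i, Suc j)} \<or> A = {(i, j), (Suc i, j)}"
    unfolding is_domino_def by blast
  from assms(2) obtain k l where B: "B = {(k, l), (k, Suc l)} \<or> B = {(k, l), (Suc k, l)}"
    unfolding is_domino_def by blast
  have top: "(i, j) \<in> A" "(k, l) \<in> B" using A B by auto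
  have AB: "x \<in> B" if "(k, l) \<in> A" "x \<in> A" "k \<le> fst x" "l \<le> snd x" for x
    using up(2)[of k l "fst x" "snd x"] that top assms(5) by auto
  have BA: "x \<in> A" if "(i, j) \<in> B" "x \<in> B" "i \<le> fst x" "j \<le> snd x" for x
    using up(1)[of i j "fst x" "snd x"] that top assms(6) by auto
  have nA: "(i, j) \<notin> B"
  proof
    assume *: "(i, j) \<in> B"
    have "A \<subseteq> B"
      using up(2)[OF *] A assms(5) by auto
    moreover have "card A = 2" "card B = 2" "finite B" using A B by auto
    ultimately show False using assms(3) card_subset_eq by metis
  qed
  have nB: "(k, l) \<notin> A"
  proof
    assume *: "(k, l) \<in> A"
    have "B \<subseteq> A"
      using up(1)[OF *] B assms(6) by auto
    moreover have "card A = 2" "card B = 2" "finite A" using A B by auto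
    ultimately show False using assms(3) card_subset_eq by metis
  qed
  from A B nA nB assms(3,4) show ?thesis
    by (elim disjE) (auto intro: that)
qed

lemma square_removable:
  assumes D: "is_diagram D"
    and A: "A = {(i, Suc j), (Suc i, Suc j)}" and B: "B = {(Suc i, j), (Suc i, Suc j)}"
    and sub: "A \<subseteq> D" "B \<subseteq> D"
    and dA: "is_diagram (D - A)" and dB: "is_diagram (D - B)"
  shows "is_diagram (D - insert (i, j) (A \<union> B))" "(i, j) \<in> D"
proof -
  show "(i, j) \<in> D" using is_diagram_down[OF D, of i "Suc j" i j] A sub by auto
  show "is_diagram (D - insert (i, j) (A \<union> B))"
  proof (rule is_diagram_DiffI[OF D])
    fix a b a' b'
    assume ab: "(a, b) \<in> insert (i, j) (A \<union> B)" "(a', b') \<in> D" "a \<le> a'" "b \<le> b'"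
    then have ge: "i \<le> a'" "j \<le> b'" using A B by auto
    show "(a', b') \<in> insert (i, j) (A \<union> B)"
    proof (cases "a' = i \<and> b' = j")
      case False
      then have "Suc j \<le> b' \<or> Suc i \<le> a'" using ge by auto
      then show ?thesis
        using removable_upD[OF dA _ ab(2), of i "Suc j"] removable_upD[OF dB _ ab(2), of "Suc i" j] ge A B
        by auto
    qed simp
  qed
qed

lemma removes_dominoI:
  assumes "is_partition \<mu>" "is_partition \<nu>" "is_domino A" "A \<subseteq> diagram \<mu>" "diagram \<nu> = diagram \<mu> - A"
  shows "removes_domino \<mu> \<nu>"
  using assms unfolding removes_domino_def by blast

lemma removes_domino_diamond:
  assumes "removes_domino \<mu> \<nu>" "removes_domino \<mu> \<rho>" "\<nu> \<noteq> \<rho>"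
  shows "\<exists>\<sigma>. removes_domino \<nu> \<sigma> \<and> removes_domino \<rho> \<sigma>"
proof -
  let ?D = "diagram \<mu>"
  obtain A where A: "is_domino A" "A \<subseteq> ?D" "diagram \<nu> = ?D - A"
    using assms(1) unfolding removes_domino_def by auto
  obtain B where B: "is_domino B" "B \<subseteq> ?D" "diagram \<rho> = ?D - B"
    using assms(2) unfolding removes_domino_def by auto
  have p: "is_partition \<mu>" "is_partition \<nu>" "is_partition \<rho>"
    using assms unfolding removes_domino_def by auto
  have D: "is_diagram ?D" "is_diagram (?D - A)" "is_diagram (?D - B)"
    using is_diagram_diagram p A(3) B(3) by metis+
  have ne: "A \<noteq> B" using assms(3) diagram_inj p A(3) B(3) by metis
  have fin: ?thesis if A': "is_domino A'" "is_domino B'" "A' \<subseteq> ?D - A" "B' \<subseteq> ?D - B"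
    "?D - A - A' = ?D - B - B'" "is_diagram (?D - A - A')" for A' B'
  proof -
    obtain \<sigma> where "is_partition \<sigma>" "diagram \<sigma> = ?D - A - A'"
      using diagram_surj A'(6) by blast
    then show ?thesis
      using removes_dominoI[of \<nu> \<sigma> A'] removes_dominoI[of \<rho> \<sigma> B'] p A B A' by metis
  qed
  have sq: "\<exists>A' B'. is_domino A' \<and> is_domino B' \<and> A' \<subseteq> ?D - A \<and> B' \<subseteq> ?D - B \<and>
      ?D - A - A' = ?D - B - B' \<and> is_diagram (?D - A - A')"
    if A_eq: "A = {(i, Suc j), (Suc i, Suc j)}" and B_eq: "B = {(Suc i, j), (Suc i, Suc j)}"
      and s: "A \<subseteq> ?D" "B \<subseteq> ?D" and dd: "is_diagram (?D - A)" "is_diagram (?D - B)"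
    for i j A B
  proof -
    note q = square_removable[OF D(1) A_eq B_eq s dd]
    have e: "?D - A - {(i, j), (Suc i, j)} = ?D - insert (i, j) (A \<union> B)"
      "?D - B - {(i, j), (i, Suc j)} = ?D - insert (i, j) (A \<union> B)"
      using A_eq B_eq by auto
    show ?thesis
    proof (intro exI conjI)
      show "is_domino {(i, j), (Suc i, j)}" "is_domino {(i, j), (i, Suc j)}"
        unfolding is_domino_def by blast+
      show "{(i, j), (Suc i, j)} \<subseteq> ?D - A" "{(i, j), (i, Suc j)} \<subseteq> ?D - B"
        using q(2) s A_eq B_eq by auto
      show "?D - A - {(i, j), (Suc i, j)} = ?D - B - {(i, j), (i, Suc j)}"
        using e by simp
      show "is_diagram (?D - A - {(i, j), (Suc i, j)})"
        using e q(1) by simp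
    qed
  qed
  show ?thesis
  proof (cases "A \<inter> B = {}")
    case True
    have "is_diagram ((?D - A) \<inter> (?D - B))"
      using D(2,3) unfolding is_diagram_def by (meson IntE IntI finite_Int)
    moreover have "(?D - A) \<inter> (?D - B) = ?D - A - B" by blast
    ultimately have "is_diagram (?D - A - B)" by simp
    moreover have "B \<subseteq> ?D - A" "A \<subseteq> ?D - B" "?D - A - B = ?D - B - A"
      using A(2) B(2) True by blast+
    ultimately show ?thesis
      by (intro fin[OF B(1) A(1)])
  next
    case False
    from domino_overlap[OF A(1) B(1) ne False A(2) B(2) D(2,3)] show ?thesis
    proof cases
      case (1 i j)
      from sq[OF 1 A(2) B(2) D(2,3)] obtain A' B' where
        "is_domino A'" "is_domino B'" "A' \<subseteq> ?D - A" "B' \<subseteq> ?D - B"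
        "?D - A - A' = ?D - B - B'" "is_diagram (?D - A - A')" by (elim exE conjE)
      then show ?thesis by (rule fin)
    next
      case (2 i j)
      from sq[OF 2 B(2) A(2) D(3,2)] obtain B' A' where
        "is_domino B'" "is_domino A'" "B' \<subseteq> ?D - B" "A' \<subseteq> ?D - A"
        "?D - B - B' = ?D - A - A'" "is_diagram (?D - B - B')"
        by (elim exE conjE)
      then show ?thesis by (intro fin[of A' B']) simp_all
    qed
  qed
qed

lemma is_two_core_of_exists: "\<exists>\<nu>. is_two_core_of \<nu> \<mu>"
proof (induction "card (diagram \<mu>)" arbitrary: \<mu> rule: less_induct)
  case less
  show ?case
  proof (cases "\<exists>\<nu>. removes_domino \<mu> \<nu>")
    case True
    then obtain \<nu> where \<nu>: "removes_domino \<mu> \<nu>" by blast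
    from less[OF removes_domino_card[OF \<nu>]] obtain \<rho> where "is_two_core_of \<rho> \<nu>" by blast
    with \<nu> show ?thesis
      unfolding is_two_core_of_def by (meson converse_rtranclp_into_rtranclp)
  next
    case False
    then show ?thesis unfolding is_two_core_of_def by blast
  qed
qed

lemma is_two_core_of_unique:
  "is_two_core_of \<nu> \<mu> \<Longrightarrow> is_two_core_of \<nu>' \<mu> \<Longrightarrow> \<nu> = \<nu>'"
proof (induction "card (diagram \<mu>)" arbitrary: \<mu> \<nu> \<nu>' rule: less_induct)
  case less
  show ?case
  proof (cases "\<exists>\<rho>. removes_domino \<mu> \<rho>")
    case False
    with less.prems have "\<nu> = \<mu>" "\<nu>' = \<mu>"
      unfolding is_two_core_of_def by (metis converse_rtranclpE)+
    then show ?thesis by simp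
  next
    case True
    have step: "\<exists>\<rho>. removes_domino \<mu> \<rho> \<and> is_two_core_of \<kappa> \<rho>" if "is_two_core_of \<kappa> \<mu>" for \<kappa>
      using that True unfolding is_two_core_of_def by (metis converse_rtranclpE)
    obtain \<rho> where \<rho>: "removes_domino \<mu> \<rho>" "is_two_core_of \<nu> \<rho>"
      using step[OF less.prems(1)] by blast
    obtain \<rho>' where \<rho>': "removes_domino \<mu> \<rho>'" "is_two_core_of \<nu>' \<rho>'"
      using step[OF less.prems(2)] by blast
    note IH = less.hyps[OF removes_domino_card[OF \<rho>(1)]] less.hyps[OF removes_domino_card[OF \<rho>'(1)]]
    show ?thesis
    proof (cases "\<rho> = \<rho>'")
      case True
      then show ?thesis using IH(1) \<rho>(2) \<rho>'(2) by blast
    next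
      case False
      from removes_domino_diamond[OF \<rho>(1) \<rho>'(1) False] obtain \<sigma> where
        \<sigma>: "removes_domino \<rho> \<sigma>" "removes_domino \<rho>' \<sigma>" by blast
      obtain \<kappa> where "is_two_core_of \<kappa> \<sigma>" using is_two_core_of_exists by blast
      with \<sigma> have "is_two_core_of \<kappa> \<rho>" "is_two_core_of \<kappa> \<rho>'"
        unfolding is_two_core_of_def by (meson converse_rtranclp_into_rtranclp)+
      then show ?thesis using IH \<rho>(2) \<rho>'(2) by metis
    qed
  qed
qed

lemma is_two_core_of_two_core: "is_two_core_of (two_core \<mu>) \<mu>"
  unfolding two_core_def
  using is_two_core_of_exists is_two_core_of_unique by (metis theI)

lemma two_core_eqI: "is_two_core_of \<nu> \<mu> \<Longrightarrow> two_core \<mu> = \<nu>"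
  using is_two_core_of_two_core is_two_core_of_unique by blast

end

theory Submission
  imports Defs
begin

text \<open>
  If the core is the staircase with \<open>k\<close> rows and at most \<open>k\<close> dominoes are added to it, then the
  horizontal dominoes (all in the top rows) and the vertical ones (all in the leftmost columns)
  do not interfere: the diagram is that of the staircase with row \<open>i\<close> lengthened by \<open>2 \<mu>\<^sub>i\<close> and
  column \<open>j\<close> lengthened by \<open>2 \<nu>\<^sub>j\<close>, for two partitions \<open>\<mu>\<close> and \<open>\<nu>\<close> (the 2-quotient) with at most
  \<open>k\<close> parts in total. For such a diagram both statistics equal the number \<open>l\<close> of parts of \<open>\<nu>\<close>,
  so they agree on every single partition: the largest repeated part is \<open>l\<close>, and, by a parity
  argument, the cells with \<open>leg = arm + 1\<close> occur once in each of the first \<open>l\<close> columns.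
\<close>

section \<open>Row and column lengths\<close>

text \<open>Rows past the last one get length 0, so membership in a diagram is a single inequality
  valid for every row index.\<close>

definition row_len :: "nat list \<Rightarrow> nat \<Rightarrow> nat" where
  "row_len \<alpha> i = (if i < length \<alpha> then \<alpha> ! i else 0)"

definition col_len :: "nat list \<Rightarrow> nat \<Rightarrow> nat" where
  "col_len \<alpha> j = card {i. (i, j) \<in> diagram \<alpha>}"

lemma mem_diagram_row: "(i, j) \<in> diagram \<alpha> \<longleftrightarrow> j < row_len \<alpha> i"
  by (simp add: diagram_def row_len_def)

lemma mem_diagram_col:
  assumes "is_partition \<alpha>"
  shows "(i, j) \<in> diagram \<alpha> \<longleftrightarrow> i < col_len \<alpha> j"
proof -
  have "finite {i. (i, j) \<in> diagram \<alpha>}"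
    by (rule finite_subset[of _ "fst ` diagram \<alpha>"]) (force simp: finite_diagram)+
  then have "{i. (i, j) \<in> diagram \<alpha>} = {..<col_len \<alpha> j}"
    unfolding col_len_def
    by (rule down_set_nat) (use is_diagram_down[OF is_diagram_diagram[OF assms]] in blast)
  then show ?thesis by blast
qed

lemma arm_eq: "arm \<alpha> (i, j) = row_len \<alpha> i - Suc j"
proof -
  have "{j'. j' > j \<and> (i, j') \<in> diagram \<alpha>} = {Suc j..<row_len \<alpha> i}"
    by (auto simp: mem_diagram_row)
  then show ?thesis by (simp add: arm_def)
qed

lemma leg_eq:
  assumes "is_partition \<alpha>"
  shows "leg \<alpha> (i, j) = col_len \<alpha> j - Suc i"
proof -
  have "{i'. i' > i \<and> (i', j) \<in> diagram \<alpha>} = {Suc i..<col_len \<alpha> j}"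
    by (auto simp: mem_diagram_col[OF assms])
  then show ?thesis by (simp add: leg_def)
qed

lemma row_len_antimono:
  assumes "is_partition \<alpha>" "i \<le> i'"
  shows "row_len \<alpha> i' \<le> row_len \<alpha> i"
proof (rule ccontr)
  assume "\<not> row_len \<alpha> i' \<le> row_len \<alpha> i"
  then have "(i', row_len \<alpha> i) \<in> diagram \<alpha>" by (simp add: mem_diagram_row)
  then have "(i, row_len \<alpha> i) \<in> diagram \<alpha>"
    using is_diagram_down[OF is_diagram_diagram[OF assms(1)]] assms(2) by blast
  then show False by (simp add: mem_diagram_row)
qed

lemma card_diagram: "card (diagram \<alpha>) = sum_list \<alpha>"
proof -
  have "diagram \<alpha> = (SIGMA i:{..<length \<alpha>}. {..<\<alpha> ! i})"
    by (auto simp: diagram_def)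
  then show ?thesis
    by (simp add: sum_list_sum_nth atLeast0LessThan)
qed

text \<open>Positivity of \<open>p\<close> excludes the padding rows of length 0, so occurrences of
  \<open>p\<close> in the list are the same as rows of length \<open>p\<close>.\<close>

lemma count_list_ge_2_iff:
  assumes "p > 0"
  shows "2 \<le> count_list \<alpha> p \<longleftrightarrow> (\<exists>i i'. i < i' \<and> row_len \<alpha> i = p \<and> row_len \<alpha> i' = p)"
proof -
  let ?I = "{i. i < length \<alpha> \<and> \<alpha> ! i = p}"
  have I: "i \<in> ?I \<longleftrightarrow> row_len \<alpha> i = p" for i
    using assms by (auto simp: row_len_def)
  have fin: "finite ?I" by simp
  have "count_list \<alpha> p = card ?I"
    by (simp add: count_list_eq_length_filter length_filter_conv_card eq_commute)
  moreover have "2 \<le> card ?I \<longleftrightarrow> (\<exists>i i'. i < i' \<and> i \<in> ?I \<and> i' \<in> ?I)"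
  proof
    assume "2 \<le> card ?I"
    then obtain T where "T \<subseteq> ?I" "card T = 2" by (metis obtain_subset_with_card_n)
    then obtain i i' where "i \<noteq> i'" "i \<in> ?I" "i' \<in> ?I" by (auto simp: card_2_iff)
    then show "\<exists>i i'. i < i' \<and> i \<in> ?I \<and> i' \<in> ?I"
      by (cases i i' rule: linorder_cases) blast+
  next
    assume "\<exists>i i'. i < i' \<and> i \<in> ?I \<and> i' \<in> ?I"
    then obtain i i' where "i < i'" "{i, i'} \<subseteq> ?I" by blast
    then have "card {i, i'} \<le> card ?I" by (intro card_mono fin)
    then show "2 \<le> card ?I" using \<open>i < i'\<close> by simp
  qed
  ultimately show ?thesis by (simp only: I)
qed

section \<open>Dominoes and cores\<close>

lemma removes_domino_sum_list:
  assumes "removes_domino \<alpha> \<kappa>"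
  shows "sum_list \<alpha> = sum_list \<kappa> + 2"
proof -
  obtain A where A: "is_domino A" "A \<subseteq> diagram \<alpha>" "diagram \<kappa> = diagram \<alpha> - A"
    using assms unfolding removes_domino_def by auto
  have "card A = 2" using A(1) by (auto simp: is_domino_def)
  moreover have "card (diagram \<alpha>) = card (diagram \<alpha> - A) + card A"
    using A(2) finite_diagram
    by (metis card_Diff_subset card_mono finite_subset le_add_diff_inverse2)
  ultimately show ?thesis using A(3) by (metis card_diagram)
qed

lemma removes_dominoes_sum_list:
  "(removes_domino ^^ w) \<alpha> \<kappa> \<Longrightarrow> sum_list \<alpha> = sum_list \<kappa> + 2 * w"
proof (induction w arbitrary: \<alpha>)
  case (Suc w)
  then obtain \<rho> where "removes_domino \<alpha> \<rho>" "(removes_domino ^^ w) \<rho> \<kappa>"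
    by (metis relpowp_Suc_D2)
  then show ?case using Suc.IH[of \<rho>] removes_domino_sum_list[of \<alpha> \<rho>] by simp
qed simp

lemma removes_domino_existsI:
  assumes "is_partition \<alpha>" "is_domino A" "A \<subseteq> diagram \<alpha>"
    and "\<And>i j i' j'. (i, j) \<in> A \<Longrightarrow> (i', j') \<in> diagram \<alpha> \<Longrightarrow> i \<le> i' \<Longrightarrow> j \<le> j' \<Longrightarrow> (i', j') \<in> A"
  shows "\<exists>\<kappa>. removes_domino \<alpha> \<kappa>"
proof -
  have "is_diagram (diagram \<alpha> - A)"
    by (rule is_diagram_DiffI[OF is_diagram_diagram[OF assms(1)]]) (rule assms(4))
  then obtain \<kappa> where "is_partition \<kappa>" "diagram \<kappa> = diagram \<alpha> - A"
    by (rule diagram_surj)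
  with assms show ?thesis unfolding removes_domino_def by blast
qed

text \<open>In a core, consecutive rows drop by exactly 1 until they reach 0: a drop of 2 or more
  frees a horizontal domino, and two equal positive rows free a vertical one.\<close>

lemma core_row_len:
  assumes part: "is_partition \<alpha>" and core: "\<not> (\<exists>\<kappa>. removes_domino \<alpha> \<kappa>)"
  shows "row_len \<alpha> i = row_len \<alpha> 0 - i"
proof (induction i)
  case (Suc i)
  let ?R = "row_len \<alpha>"
  note anti = row_len_antimono[OF part]
  have "?R i \<le> ?R (Suc i) + 1"
  proof (rule ccontr)
    assume *: "\<not> ?thesis"
    \<comment> \<open>The candidate domino consists of the last two cells of row
      \<open>i\<close>.\<close>
    define j where "j = ?R i - 2"
    have j: "?R i = Suc (Suc j)" "?R (Suc i) \<le> j" using * by (auto simp: j_def)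
    have "\<exists>\<kappa>. removes_domino \<alpha> \<kappa>"
    proof (rule removes_domino_existsI[OF part])
      show "is_domino {(i, j), (i, Suc j)}" unfolding is_domino_def by blast
      show "{(i, j), (i, Suc j)} \<subseteq> diagram \<alpha>" by (simp add: mem_diagram_row j)
    next
      fix a b a' b'
      assume ab: "(a, b) \<in> {(i, j), (i, Suc j)}" "(a', b') \<in> diagram \<alpha>" "a \<le> a'" "b \<le> b'"
      then have "a' = i" using anti[of "Suc i" a'] j by (cases "a' = i") (auto simp: mem_diagram_row)
      then show "(a', b') \<in> {(i, j), (i, Suc j)}" using ab j by (auto simp: mem_diagram_row)
    qed
    then show False using core by blast
  qed
  moreover have "?R (Suc i) \<noteq> ?R i" if pos: "?R i > 0"
  proof
    assume eq: "?R (Suc i) = ?R i"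
    let ?c = "col_len \<alpha> (?R i - 1)"
    have c: "x < ?c \<longleftrightarrow> ?R i \<le> ?R x" for x
      using mem_diagram_col[OF part, of x "?R i - 1"] mem_diagram_row[of x "?R i - 1" \<alpha>] pos
      by auto
    \<comment> \<open>The block of rows of length \<open>?R i\<close> ends at row
      \<open>?c - 1\<close>; a vertical domino is removable only at the bottom of this block, in its
      last two rows.\<close>
    define i' where "i' = ?c - 2"
    have "Suc i < ?c" by (simp only: c eq order_refl)
    then have i': "i \<le> i'" "?c = Suc (Suc i')" by (auto simp: i'_def)
    define j where "j = ?R i - 1"
    have "?R i \<le> ?R i'" "?R i \<le> ?R (Suc i')" "\<not> ?R i \<le> ?R (Suc (Suc i'))"
      using i' c[of i'] c[of "Suc i'"] c[of "Suc (Suc i')"] by auto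
    then have R: "?R i' = Suc j" "?R (Suc i') = Suc j" "?R (Suc (Suc i')) \<le> j"
      using anti[OF i'(1)] anti[of i' "Suc i'"] pos by (auto simp: j_def)
    have "\<exists>\<kappa>. removes_domino \<alpha> \<kappa>"
    proof (rule removes_domino_existsI[OF part])
      show "is_domino {(i', j), (Suc i', j)}" unfolding is_domino_def by blast
      show "{(i', j), (Suc i', j)} \<subseteq> diagram \<alpha>" by (simp add: mem_diagram_row R)
    next
      fix a b a' b'
      assume ab: "(a, b) \<in> {(i', j), (Suc i', j)}" "(a', b') \<in> diagram \<alpha>" "a \<le> a'" "b \<le> b'"
      then have "\<not> Suc (Suc i') \<le> a'"
        using anti[of "Suc (Suc i')" a'] R by (auto simp: mem_diagram_row)
      then have "a' = i' \<or> a' = Suc i'" using ab by auto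
      then show "(a', b') \<in> {(i', j), (Suc i', j)}" using ab R by (auto simp: mem_diagram_row)
    qed
    then show False using core by blast
  qed
  ultimately show ?case using Suc.IH anti[of i "Suc i"] by (cases "?R i = 0") auto
qed simp

lemma core_diagram:
  assumes part: "is_partition \<alpha>" and core: "\<not> (\<exists>\<kappa>. removes_domino \<alpha> \<kappa>)"
    and size: "sum_list \<alpha> = Suc k choose 2"
  shows "diagram \<alpha> = {(i, j). i + j < k}"
proof -
  define q where "q = row_len \<alpha> 0"
  have row: "row_len \<alpha> i = q - i" for i
    unfolding q_def by (rule core_row_len[OF part core])
  have D: "diagram \<alpha> = {(i, j). i + j < q}"
    by (auto simp: mem_diagram_row row)
  have "{(i, j). i + j < q} = (SIGMA i:{..<q}. {..<q - i})" by auto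
  then have "sum_list \<alpha> = (\<Sum>i<q. q - i)"
    using card_diagram[of \<alpha>] D by simp
  also have "\<dots> = (\<Sum>i<q. Suc i)"
    by (subst sum.nat_diff_reindex[symmetric]) (auto intro!: sum.cong)
  also have "\<dots> = Suc q choose 2"
    by (induction q) (auto simp: numeral_2_eq_2)
  finally have eq: "Suc q choose 2 = Suc k choose 2" using size by simp
  \<comment> \<open>Triangular numbers increase strictly, so the size of a staircase determines its
    number of rows.\<close>
  have mono: "Suc a choose 2 < Suc b choose 2" if "a < b" for a b :: nat
    using that
  proof (induction rule: strict_inc_induct)
    case (base i)
    then show ?case by (simp add: numeral_2_eq_2)
  next
    case (step i)
    then show ?case by (simp add: numeral_2_eq_2)
  qed
  have "q = k" using eq mono[of q k] mono[of k q] by (cases q k rule: linorder_cases) auto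
  with D show ?thesis by simp
qed

section \<open>Staircases with separated horizontal and vertical dominoes\<close>

text \<open>The condition \<open>i + j < k\<close> describes the staircase, and each disjunct
  lengthens it, by rows or by columns. The numbers of parts \<open>m\<close> and \<open>l\<close>
  are explicit because their sum is what has to be bounded. Transposition exchanges the two
  families.\<close>

definition sep_shape ::
    "nat \<Rightarrow> (nat \<Rightarrow> nat) \<Rightarrow> (nat \<Rightarrow> nat) \<Rightarrow> nat \<Rightarrow> nat \<Rightarrow> (nat \<times> nat) set \<Rightarrow> bool" where
  "sep_shape k \<mu> \<nu> m l D \<longleftrightarrow> antimono \<mu> \<and> antimono \<nu> \<and>
     (\<forall>i. 0 < \<mu> i \<longleftrightarrow> i < m) \<and> (\<forall>j. 0 < \<nu> j \<longleftrightarrow> j < l) \<and>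
     D = {(i, j). i + j < k + 2 * \<mu> i \<or> i + j < k + 2 * \<nu> j}"

lemma sep_shape_swap:
  assumes "sep_shape k \<mu> \<nu> m l D"
  shows "sep_shape k \<nu> \<mu> l m (prod.swap ` D)"
  using assms unfolding sep_shape_def by (auto simp: image_iff add.commute)

lemma is_diagram_swap: "is_diagram D \<Longrightarrow> is_diagram (prod.swap ` D)"
  unfolding is_diagram_def by (auto simp: image_iff) (metis swap_simp)

text \<open>While \<open>m + l < k\<close>, a horizontal domino cannot reach the lengthened columns:
  it has to start exactly where row \<open>i\<close> ends, so it raises \<open>\<mu> i\<close> by 1.
  It creates at most one new part.\<close>

lemma sep_shape_add_horizontal:
  assumes D': "is_diagram D'" and A: "A = {(i, j), (i, Suc j)}" "A \<subseteq> D'"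
    and sep: "sep_shape k \<mu> \<nu> m l (D' - A)" and lt: "m + l < k"
  shows "\<exists>\<mu>' m'. sep_shape k \<mu>' \<nu> m' l D' \<and> m' \<le> Suc m"
proof -
  have anti: "\<mu> b \<le> \<mu> a" "\<nu> b \<le> \<nu> a" if "a \<le> b" for a b
    using sep that by (auto simp: sep_shape_def antimono_def)
  have pos: "0 < \<mu> a \<longleftrightarrow> a < m" "0 < \<nu> b \<longleftrightarrow> b < l" for a b
    using sep by (auto simp: sep_shape_def)
  have mem: "(a, b) \<in> D' - A \<longleftrightarrow> a + b < k + 2 * \<mu> a \<or> a + b < k + 2 * \<nu> b" for a b
    using sep by (auto simp: sep_shape_def)
  have ij: "(i, j) \<in> D'" "(i, Suc j) \<in> D'" using A by auto
  have notin: "k + 2 * \<mu> i \<le> i + j" "k + 2 * \<nu> j \<le> i + j"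
    using mem[of i j] A by auto
  \<comment> \<open>The cell above the right half of the domino was present before. Column
    \<open>Suc j\<close> is too short to account for it, so row \<open>i - 1\<close> must be
    lengthened further than row \<open>i\<close>.\<close>
  have above: "\<mu> i < \<mu> (i - 1) \<and> i - 1 < m" if "i > 0"
  proof -
    have "(i - 1, Suc j) \<in> D' - A"
      using is_diagram_down[OF D' ij(2), of "i - 1" "Suc j"] A that by auto
    then have "i + j < k + 2 * \<mu> (i - 1)"
      using mem notin anti(2)[of j "Suc j"] that by auto
    then show ?thesis using notin pos(1)[of "i - 1"] by auto
  qed
  have im: "i \<le> m" using above by (cases "i = 0") auto
  then have "j > 0" using notin lt by auto
  then have "(i, j - 1) \<in> D' - A"
    using is_diagram_down[OF D' ij(1), of i "j - 1"] A by auto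
  then have "i + j \<le> k + 2 * \<mu> i \<or> i + j \<le> k + 2 * \<nu> (j - 1)"
    using mem[of i "j - 1"] \<open>j > 0\<close> by auto
  \<comment> \<open>From \<open>i \<le> m\<close> and \<open>k \<le> i + j\<close> follows
    \<open>j > l\<close>, so the left neighbour of the domino belongs to the shape through its
    row.\<close>
  moreover have "\<nu> (j - 1) = 0"
    using pos(2)[of "j - 1"] im lt notin by (cases "\<nu> (j - 1) = 0") auto
  ultimately have eq: "i + j = k + 2 * \<mu> i" using notin by auto
  define \<mu>' where "\<mu>' = \<mu>(i := Suc (\<mu> i))"
  define m' where "m' = max m (Suc i)"
  have "antimono \<mu>'"
    unfolding antimono_def
  proof (intro allI impI)
    fix a b :: nat assume ab: "a \<le> b"
    show "\<mu>' b \<le> \<mu>' a"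
    proof (cases "b = i \<and> a < i")
      case True
      then show ?thesis using anti(1)[of a "i - 1"] above by (fastforce simp: \<mu>'_def)
    next
      case False
      then show ?thesis using anti(1)[OF ab] ab by (auto simp: \<mu>'_def)
    qed
  qed
  moreover have "0 < \<mu>' a \<longleftrightarrow> a < m'" for a
    using pos(1)[of a] im by (auto simp: \<mu>'_def m'_def)
  moreover have "D' = {(a, b). a + b < k + 2 * \<mu>' a \<or> a + b < k + 2 * \<nu> b}"
  proof -
    have "(a, b) \<in> D' \<longleftrightarrow> a + b < k + 2 * \<mu>' a \<or> a + b < k + 2 * \<nu> b" for a b
    proof (cases "(a, b) \<in> A")
      case True
      then show ?thesis using A eq by (auto simp: \<mu>'_def)
    next
      case False
      then have "a = i \<Longrightarrow> b \<noteq> j \<and> b \<noteq> Suc j" using A by auto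
      then show ?thesis using mem[of a b] False eq by (auto simp: \<mu>'_def)
    qed
    then show ?thesis by auto
  qed
  ultimately have "sep_shape k \<mu>' \<nu> m' l D'"
    using sep unfolding sep_shape_def by blast
  moreover have "m' \<le> Suc m" using im by (simp add: m'_def)
  ultimately show ?thesis by blast
qed

text \<open>The vertical case is the horizontal one applied to the transposed diagram.\<close>

lemma sep_shape_add_domino:
  assumes D': "is_diagram D'" and A: "is_domino A" "A \<subseteq> D'"
    and sep: "sep_shape k \<mu> \<nu> m l (D' - A)" and lt: "m + l < k"
  shows "\<exists>\<mu> \<nu> m' l'. sep_shape k \<mu> \<nu> m' l' D' \<and> m' + l' \<le> Suc (m + l)"
proof -
  from A(1) consider i j where "A = {(i, j), (i, Suc j)}" | i j where "A = {(i, j), (Suc i, j)}"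
    unfolding is_domino_def by blast
  then show ?thesis
  proof cases
    case 1
    then show ?thesis
      using sep_shape_add_horizontal[OF D' 1 A(2) sep lt] by (metis add_Suc add_le_mono1)
  next
    case (2 i j)
    have swapA: "prod.swap ` A = {(j, i), (j, Suc i)}" "prod.swap ` A \<subseteq> prod.swap ` D'"
      using 2 A(2) by auto
    have "prod.swap ` (D' - A) = prod.swap ` D' - prod.swap ` A"
      by (simp add: image_set_diff)
    then have "sep_shape k \<nu> \<mu> l m (prod.swap ` D' - prod.swap ` A)"
      using sep_shape_swap[OF sep] by simp
    then obtain \<nu>' l' where "sep_shape k \<nu>' \<mu> l' m (prod.swap ` D')" "l' \<le> Suc l"
      using sep_shape_add_horizontal[OF is_diagram_swap[OF D'] swapA] lt by (metis add.commute)
    moreover have "prod.swap ` prod.swap ` D' = D'" by (simp add: image_image)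
    ultimately have "sep_shape k \<mu> \<nu>' m l' D'" by (metis sep_shape_swap)
    with \<open>l' \<le> Suc l\<close> show ?thesis by (metis add_Suc_right nat_add_left_cancel_le)
  qed
qed

text \<open>The dominoes are put back one at a time. Each adds at most one part, so before each
  addition the number of parts is still below \<open>k\<close>.\<close>

lemma sep_shape_of_steps:
  assumes "(removes_domino ^^ w) \<alpha> \<kappa>" "diagram \<kappa> = {(i, j). i + j < k}" "w \<le> k"
  shows "\<exists>\<mu> \<nu> m l. sep_shape k \<mu> \<nu> m l (diagram \<alpha>) \<and> m + l \<le> w"
  using assms(1,3)
proof (induction w arbitrary: \<alpha>)
  case 0
  then have "sep_shape k (\<lambda>_. 0) (\<lambda>_. 0) 0 0 (diagram \<alpha>)"
    using assms(2) by (simp add: sep_shape_def antimono_def)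
  then show ?case by fastforce
next
  case (Suc w)
  obtain \<rho> where \<rho>: "removes_domino \<alpha> \<rho>" "(removes_domino ^^ w) \<rho> \<kappa>"
    using Suc.prems(1) by (metis relpowp_Suc_D2)
  obtain A where A: "is_domino A" "A \<subseteq> diagram \<alpha>" "diagram \<rho> = diagram \<alpha> - A" "is_partition \<alpha>"
    using \<rho>(1) unfolding removes_domino_def by auto
  obtain \<mu> \<nu> m l where "sep_shape k \<mu> \<nu> m l (diagram \<alpha> - A)" and w: "m + l \<le> w"
    using Suc.IH[OF \<rho>(2)] Suc.prems(2) A(3) by auto
  then have "\<exists>\<mu> \<nu> m' l'. sep_shape k \<mu> \<nu> m' l' (diagram \<alpha>) \<and> m' + l' \<le> Suc (m + l)"
    using Suc.prems(2) by (intro sep_shape_add_domino[OF is_diagram_diagram[OF A(4)] A(1,2)]) auto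
  with w show ?case by (meson Suc_le_mono order_trans)
qed

section \<open>The two statistics\<close>

locale separated =
  fixes \<alpha> :: "nat list" and k m l :: nat and \<mu> \<nu> :: "nat \<Rightarrow> nat"
  assumes part: "is_partition \<alpha>"
    and sep: "sep_shape k \<mu> \<nu> m l (diagram \<alpha>)"
    and ml: "m + l \<le> k"
begin

abbreviation "R \<equiv> row_len \<alpha>"
abbreviation "C \<equiv> col_len \<alpha>"

lemma anti: "i \<le> i' \<Longrightarrow> \<mu> i' \<le> \<mu> i" "j \<le> j' \<Longrightarrow> \<nu> j' \<le> \<nu> j"
  using sep by (auto simp: sep_shape_def antimono_def)

lemma zero: "m \<le> i \<Longrightarrow> \<mu> i = 0" "l \<le> j \<Longrightarrow> \<nu> j = 0"
  using sep by (auto simp: sep_shape_def) (metis gr0I leD)+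

lemma pos: "j < l \<Longrightarrow> 0 < \<nu> j"
  using sep by (simp add: sep_shape_def)

lemma row: "j < R i \<longleftrightarrow> i + j < k + 2 * \<mu> i \<or> i + j < k + 2 * \<nu> j"
  using sep mem_diagram_row[of i j \<alpha>] by (auto simp: sep_shape_def)

lemma col: "i < C j \<longleftrightarrow> i + j < k + 2 * \<mu> i \<or> i + j < k + 2 * \<nu> j"
  using sep mem_diagram_col[OF part, of i j] by (auto simp: sep_shape_def)

text \<open>In such a row all columns \<open>j < l\<close> already lie in the staircase, and the
  remaining columns are not lengthened; only \<open>\<mu> i\<close> affects the row length.
  \<open>C_left\<close> is the transpose.\<close>

lemma R_top:
  assumes "i + l \<le> k"
  shows "R i + i = k + 2 * \<mu> i"
proof -
  have "j < R i \<longleftrightarrow> j < k + 2 * \<mu> i - i" for j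
  proof (cases "j < l")
    case True then show ?thesis using assms by (auto simp: row)
  next
    case False then show ?thesis using assms zero(2)[of j] by (auto simp: row)
  qed
  then have "R i = k + 2 * \<mu> i - i" by (meson linorder_neqE_nat less_irrefl)
  then show ?thesis using assms by simp
qed

lemma C_left:
  assumes "j + m \<le> k"
  shows "C j + j = k + 2 * \<nu> j"
proof -
  have "i < C j \<longleftrightarrow> i < k + 2 * \<nu> j - j" for i
  proof (cases "i < m")
    case True then show ?thesis using assms by (auto simp: col)
  next
    case False then show ?thesis using assms zero(1)[of i] by (auto simp: col)
  qed
  then have "C j = k + 2 * \<nu> j - j" by (meson linorder_neqE_nat less_irrefl)
  then show ?thesis using assms by simp
qed

section \<open>Cells whose leg exceeds their arm by one\<close>

lemma hook_iff:
  "{v \<in> diagram \<alpha>. leg \<alpha> v = arm \<alpha> v + 1} = {(i, j). j < R i \<and> C j + j = R i + i + 1}"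
proof -
  have "(i, j) \<in> diagram \<alpha> \<and> leg \<alpha> (i, j) = arm \<alpha> (i, j) + 1 \<longleftrightarrow> j < R i \<and> C j + j = R i + i + 1" for i j
    using mem_diagram_row[of i j \<alpha>] mem_diagram_col[OF part, of i j]
    by (auto simp: arm_eq leg_eq[OF part])
  then show ?thesis by auto
qed

text \<open>If the formulas of \<open>R_top\<close> and \<open>C_left\<close> both applied, the hook
  equation would equate numbers of different parity. It remains to exclude columns
  \<open>j \<ge> l\<close>.\<close>

lemma hook_cell_left:
  assumes cell: "j < R i" and hook: "C j + j = R i + i + 1"
  shows "j < l" "k < i + l"
proof -
  have odd: "\<not> (i + l \<le> k \<and> j + m \<le> k)"
  proof
    assume "i + l \<le> k \<and> j + m \<le> k"
    then have "k + 2 * \<nu> j = k + 2 * \<mu> i + 1" using hook R_top[of i] C_left[of j] by simp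
    then show False by presburger
  qed
  show "j < l"
  proof (rule ccontr)
    assume j: "\<not> j < l"
    then have \<nu>j: "\<nu> j = 0" using zero(2) by simp
    have "i < m \<or> i + j < k" using cell zero(1)[of i] \<nu>j by (cases "i < m") (auto simp: row)
    then have il: "i + l \<le> k" using ml j by auto
    have ic: "i < C j" using cell row col by blast
    \<comment> \<open>The bottom cell of column \<open>j\<close> lies in its lengthened row, which
      bounds \<open>C j + j\<close> by \<open>k + 2 * \<mu> i = R i + i\<close>, one less than the
      hook equation demands.\<close>
    then have "C j - 1 + j < k + 2 * \<mu> (C j - 1)"
      using col[of "C j - 1" j] \<nu>j by auto
    moreover have "\<mu> (C j - 1) \<le> \<mu> i" using ic by (intro anti) auto
    ultimately show False using hook R_top[OF il] by auto
  qed
  then show "k < i + l" using odd ml by auto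
qed

text \<open>The length of the row that contains the only cell with \<open>leg = arm + 1\<close> in column \<open>j\<close>.\<close>

definition ge_parts :: "nat \<Rightarrow> nat" where
  "ge_parts j = card {j'. j' < l \<and> \<nu> j \<le> \<nu> j'}"

text \<open>As \<open>\<nu>\<close> is decreasing, these columns form an initial segment; positivity
  of \<open>\<nu> j\<close> keeps them below \<open>l\<close>.\<close>

lemma ge_parts:
  assumes "j < l"
  shows "j' < ge_parts j \<longleftrightarrow> \<nu> j \<le> \<nu> j'"
proof -
  have "{j'. j' < l \<and> \<nu> j \<le> \<nu> j'} = {..<ge_parts j}"
    unfolding ge_parts_def by (rule down_set_nat) (auto intro: order_trans anti)
  moreover have "j' < l" if "\<nu> j \<le> \<nu> j'" using that pos[OF assms] zero(2)[of j'] by force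
  ultimately show ?thesis by auto
qed

text \<open>The equation fixes \<open>R i + i = k + 2 * \<nu> j - 1\<close> in a row with
  \<open>\<mu> i = 0\<close>. Such a row consists exactly of the columns \<open>j'\<close> with
  \<open>\<nu> j \<le> \<nu> j'\<close>, so \<open>j\<close> determines \<open>R i\<close>, hence
  \<open>i\<close>.\<close>

lemma hook_cells:
  "{(i, j). j < R i \<and> C j + j = R i + i + 1} = (\<lambda>j. (k + 2 * \<nu> j - ge_parts j - 1, j)) ` {..<l}"
proof (intro equalityI subsetI)
  fix v assume "v \<in> {(i, j). j < R i \<and> C j + j = R i + i + 1}"
  then obtain i j where v: "v = (i, j)" and h: "j < R i" "C j + j = R i + i + 1" by blast
  note jl = hook_cell_left[OF h]
  have Ri: "R i + i + 1 = k + 2 * \<nu> j" using h C_left[of j] jl ml by simp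
  have \<mu>i: "\<mu> i = 0" using jl ml by (intro zero) auto
  \<comment> \<open>The last cell of row \<open>i\<close> gives this bound, and the first column
    outside the row gives the reverse one.\<close>
  have "R i \<le> ge_parts j"
  proof (rule ccontr)
    assume s: "\<not> R i \<le> ge_parts j"
    then have "\<not> \<nu> j \<le> \<nu> (R i - 1)" using ge_parts[OF jl(1), of "R i - 1"] by auto
    moreover have "i + (R i - 1) < k + 2 * \<nu> (R i - 1)"
      using row[of "R i - 1" i] s \<mu>i by auto
    ultimately show False using Ri by auto
  qed
  moreover have "ge_parts j \<le> R i"
  proof (rule ccontr)
    assume "\<not> ge_parts j \<le> R i"
    then have "\<nu> j \<le> \<nu> (R i)" using ge_parts[OF jl(1), of "R i"] by auto
    moreover have "k + 2 * \<nu> (R i) \<le> i + R i" using row[of "R i" i] by auto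
    ultimately show False using Ri by auto
  qed
  ultimately have "i = k + 2 * \<nu> j - ge_parts j - 1" using Ri by auto
  then show "v \<in> (\<lambda>j. (k + 2 * \<nu> j - ge_parts j - 1, j)) ` {..<l}" using v jl by auto
next
  fix v assume "v \<in> (\<lambda>j. (k + 2 * \<nu> j - ge_parts j - 1, j)) ` {..<l}"
  then obtain j where j: "j < l" and v: "v = (k + 2 * \<nu> j - ge_parts j - 1, j)" by blast
  define i where "i = k + 2 * \<nu> j - ge_parts j - 1"
  \<comment> \<open>This bound keeps the subtraction defining \<open>i\<close> from truncating and
    places row \<open>i\<close> below the rows lengthened by \<open>\<mu>\<close>.\<close>
  have sl: "ge_parts j \<le> l"
    using ge_parts[OF j, of l] pos[OF j] zero(2)[of l] by auto
  then have i: "i + ge_parts j + 1 = k + 2 * \<nu> j" using ml pos[OF j] by (simp add: i_def)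
  then have "m \<le> i" using ml sl pos[OF j] by auto
  then have \<mu>i: "\<mu> i = 0" by (rule zero)
  have "j' < R i \<longleftrightarrow> j' < ge_parts j" for j'
  proof (cases "j' < ge_parts j")
    case True
    then have "\<nu> j \<le> \<nu> j'" using ge_parts[OF j] by simp
    then show ?thesis using True i by (simp add: row)
  next
    case False
    then have "\<nu> j' < \<nu> j" using ge_parts[OF j, of j'] by simp
    then show ?thesis using False i \<mu>i by (simp add: row)
  qed
  then have Ri: "R i = ge_parts j" by (meson linorder_neqE_nat less_irrefl)
  have "j < ge_parts j" using ge_parts[OF j] by simp
  moreover have "C j + j = k + 2 * \<nu> j" using j ml by (intro C_left) simp
  ultimately show "v \<in> {(i, j). j < R i \<and> C j + j = R i + i + 1}"
    unfolding v i_def[symmetric] using Ri i by simp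
qed

lemma h11_eq: "h11 \<alpha> = l"
proof -
  have "inj_on (\<lambda>j. (k + 2 * \<nu> j - ge_parts j - 1, j)) {..<l}" by (auto intro: inj_onI)
  then show ?thesis
    unfolding h11_def hook_iff hook_cells by (simp add: card_image)
qed

section \<open>The largest repeated part\<close>

text \<open>For \<open>l > 0\<close>, rows \<open>k - l\<close> and \<open>k - l + 1\<close> both
  have length \<open>l\<close>. Any longer row lies above them, where
  \<open>R i = k + 2 * \<mu> i - i\<close> is strictly decreasing, so no longer part
  repeats.\<close>

lemma a2_eq: "a2 \<alpha> = l"
proof -
  let ?S = "insert 0 {p \<in> set \<alpha>. count_list \<alpha> p \<ge> 2}"
  have rep: "p \<in> ?S \<longleftrightarrow> (\<exists>i i'. i < i' \<and> R i = p \<and> R i' = p)" if "p > 0" for p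
  proof -
    have "p \<in> set \<alpha>" if "2 \<le> count_list \<alpha> p"
      using that count_notin[of p \<alpha>] by (cases "p \<in> set \<alpha>") auto
    then have "p \<in> ?S \<longleftrightarrow> 2 \<le> count_list \<alpha> p" using that by blast
    then show ?thesis by (simp only: count_list_ge_2_iff[OF that])
  qed
  have Rkl: "R (k - l) = l" using R_top[of "k - l"] zero(1)[of "k - l"] ml by simp
  have "Max ?S = l"
  proof (rule Max_eqI)
    show "l \<in> ?S"
    proof (cases "l = 0")
      case False
      have "j < R (Suc (k - l)) \<longleftrightarrow> j < l" for j
      proof (cases "j < l")
        case True
        then show ?thesis using pos[of j] ml by (auto simp: row)
      next
        case j: False
        then show ?thesis using zero(1)[of "Suc (k - l)"] zero(2)[of j] ml by (simp add: row)
      qed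
      then have "R (Suc (k - l)) = l" by (meson linorder_neqE_nat less_irrefl)
      then show ?thesis using rep[of l] False Rkl lessI[of "k - l"] by blast
    qed simp
  next
    fix p assume p: "p \<in> ?S"
    show "p \<le> l"
    proof (rule ccontr)
      assume "\<not> p \<le> l"
      then obtain i i' where i: "i < i'" "R i = p" "R i' = p" "l < p"
        using rep[of p] p by auto
      have "i' < k - l"
        using row_len_antimono[OF part, of "k - l" i'] Rkl i
        by (cases "k - l \<le> i'") auto
      then have "R i + i = k + 2 * \<mu> i" "R i' + i' = k + 2 * \<mu> i'"
        using i(1) by (auto intro!: R_top)
      then show False using i anti(1)[of i i'] by auto
    qed
  qed simp
  then show ?thesis by (simp only: a2_def)
qed

end

text \<open>Each removed domino costs two cells, so the size bound says that at most
  \<open>k\<close> dominoes separate the partition from its core.\<close>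

lemma h11_eq_a2:
  assumes part: "is_partition \<alpha>" and core: "sum_list (two_core \<alpha>) = Suc k choose 2"
    and n: "sum_list \<alpha> \<le> (Suc k choose 2) + 2 * k"
  shows "h11 \<alpha> = a2 \<alpha>"
proof -
  let ?\<kappa> = "two_core \<alpha>"
  have two_core: "removes_domino\<^sup>*\<^sup>* \<alpha> ?\<kappa>" "\<not> (\<exists>\<rho>. removes_domino ?\<kappa> \<rho>)"
    using is_two_core_of_two_core[of \<alpha>] by (auto simp: is_two_core_of_def)
  obtain w where w: "(removes_domino ^^ w) \<alpha> ?\<kappa>"
    using two_core(1) by (auto simp: rtranclp_power)
  have "is_partition ?\<kappa>"
    using two_core(1) part by (induction rule: rtranclp_induct) (auto simp: removes_domino_def)
  then have D: "diagram ?\<kappa> = {(i, j). i + j < k}"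
    using core_diagram two_core(2) core by blast
  have "sum_list \<alpha> = sum_list ?\<kappa> + 2 * w"
    using w by (rule removes_dominoes_sum_list)
  then have "w \<le> k" using n core by simp
  from sep_shape_of_steps[OF w D this] obtain \<mu> \<nu> m l
    where "sep_shape k \<mu> \<nu> m l (diagram \<alpha>)" "m + l \<le> w" by blast
  then interpret separated \<alpha> k m l \<mu> \<nu>
    using part \<open>w \<le> k\<close> by unfold_locales auto
  show ?thesis by (simp add: h11_eq a2_eq)
qed

theorem theorem1p5:
  fixes n k :: nat
  assumes "real k \<ge> (real n - real ((k + 1) choose 2)) / 2"
  shows "\<forall>r::nat. card {\<mu> \<in> partitions_with_core_size n ((k + 1) choose 2). h11 \<mu> = r}
               = card {\<mu> \<in> partitions_with_core_size n ((k + 1) choose 2). a2 \<mu> = r}"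
proof -
  have "real n \<le> real (((k + 1) choose 2) + 2 * k)" using assms by simp
  then have "n \<le> (Suc k choose 2) + 2 * k" by (simp only: of_nat_le_iff Suc_eq_plus1)
  \<comment> \<open>The statistics agree on each partition, so the two sets being counted
    coincide.\<close>
  then have "h11 \<mu> = a2 \<mu>" if "\<mu> \<in> partitions_with_core_size n ((k + 1) choose 2)" for \<mu>
    using that h11_eq_a2[of \<mu> k] by (simp add: partitions_with_core_size_def)
  then show ?thesis by (metis (mono_tags, lifting) Collect_cong)
qed

end
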